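(* Let $\mathcal{A}=\{\mathsf{A}^{(1)},\ldots,\mathsf{A}^{(g)}\}$ be a set of $g$ $d$-dimensional measurements. For any faithful quantum state $\rho$, denote $F_\rho(\mathcal{A}):=\{F_\rho(\mathsf{A}^{(i)})\}_{i=1}^g$. If there exists a faithful state $\rho>0$ such that $$\mathfrak{h}\left(F_\rho(\mathcal{A})\right)>\min\left(d,\prod_{i=1}^g\ell(\mathsf{A}^{(i)})\right),$$ then $\mathcal{A}$ is incompatible.
   Context: A ($d$-dimensional) measurement (POVM) $\mathsf{A}$ is a map $x\mapsto\mathsf{A}_x$ from a finite set of integers to $M_d(\mathbb{C})$ with $\mathsf{A}_x\geq0$ and $\sum_x\mathsf{A}_x=\mathbb{1}$. Post-processing preorder: $\mathsf{A}\preccurlyeq\mathsf{B}$ if there is a matrix $(\mu_{xy})$ with nonnegative entries and $\sum_x\mu_{xy}=1$ for all $y$ such that $\mathsf{A}_x=\sum_y\mu_{xy}\mathsf{B}_y$ for all $x$. A set $\mathcal{A}$ of measurements is compatible if there is a measurement $\mathsf{C}$ with $\mathsf{A}\preccurlyeq\mathsf{C}$ for all $\mathsf{A}\in\mathcal{A}$, and incompatible otherwise. A measurement is simple if for $x\neq y$ there is no $c\geq0$ with $\mathsf{A}_x=c\mathsf{A}_y$. Every class of the equivalence relation $\mathsf{A}\preccurlyeq\mathsf{B}\preccurlyeq\mathsf{A}$ has a simple representative (obtained by merging, i.e. adding, collinear effects), unique up to bijective relabeling; $\ell(\mathsf{A})=\ell([\mathsf{A}])$ is the number of outcomes of the simple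 representative of the class of $\mathsf{A}$. A faithful state is a positive definite $\rho\in M_d(\mathbb{C})$ with $\mathrm{tr}[\rho]=1$. The generalized Fisher information map is $F_\rho(\mathsf{A})=\sum_x\frac{|\rho^{1/2}\mathsf{A}_x\rangle\langle\rho^{1/2}\mathsf{A}_x|}{\mathrm{tr}[\rho\mathsf{A}_x]}\in M_{d^2}(\mathbb{C})$ (terms with zero denominator omitted), where $|E\rangle=\sum_{j,k}\langle k|E|j\rangle\,|j\rangle\otimes|k\rangle\in\mathbb{C}^{d^2}$ is the vectorization of $E$ and $\langle E|$ its conjugate transpose. For a finite family $X=\{X_i\}_{i\in[n]}$ of selfadjoint matrices of the same size, its height is $\mathfrak{h}(X):=\min\{\mathrm{tr}[H]: H\geq X_i\ \forall i\in[n]\}$, the minimum being over selfadjoint matrices $H$ of that size and $\geq$ the positive semidefinite order. *)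

theory Defs
  imports "HOL-Analysis.Analysis"
begin

definition dagger :: "complex^'n^'m \<Rightarrow> complex^'m^'n" where
  "dagger M = (\<chi> i j. cnj (M $ j $ i))"

definition selfadjoint :: "complex^'n^'n \<Rightarrow> bool" where
  "selfadjoint M \<longleftrightarrow> dagger M = M"

definition cinner_vec :: "complex^'n \<Rightarrow> complex^'n \<Rightarrow> complex" where
  "cinner_vec v w = (\<Sum>i\<in>UNIV. cnj (v $ i) * w $ i)"

text \<open>For selfadjoint matrices the quadratic form is real-valued, so taking real parts below
  discards nothing.\<close>

definition psd :: "complex^'n^'n \<Rightarrow> bool" where
  "psd M \<longleftrightarrow> selfadjoint M \<and> (\<forall>v. 0 \<le> Re (cinner_vec v (M *v v)))"

definition posdef :: "complex^'n^'n \<Rightarrow> bool" where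
  "posdef M \<longleftrightarrow> selfadjoint M \<and> (\<forall>v. v \<noteq> 0 \<longrightarrow> 0 < Re (cinner_vec v (M *v v)))"

definition mat_sqrt :: "complex^'n^'n \<Rightarrow> complex^'n^'n" where
  "mat_sqrt M = (THE R. psd R \<and> R ** R = M)"

text \<open>A measurement is a map from a finite set of integers to matrices, encoded as a partial map:
  \<^term>\<open>dom A\<close> is the set of outcomes.\<close>

type_synonym 'n effects = "int \<rightharpoonup> complex^'n^'n"

definition eff :: "'n::finite effects \<Rightarrow> int \<Rightarrow> complex^'n^'n" where
  "eff A x = the (A x)"

definition measurement :: "'n::finite effects \<Rightarrow> bool" where
  "measurement A \<longleftrightarrow>
     finite (dom A) \<and> (\<forall>x\<in>dom A. psd (eff A x)) \<and> (\<Sum>x\<in>dom A. eff A x) = mat 1"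

definition postproc :: "'n::finite effects \<Rightarrow> 'n effects \<Rightarrow> bool"  (infix "\<preceq>\<^sub>p" 50) where
  "A \<preceq>\<^sub>p B \<longleftrightarrow>
     (\<exists>\<mu> :: int \<Rightarrow> int \<Rightarrow> real.
        (\<forall>x\<in>dom A. \<forall>y\<in>dom B. 0 \<le> \<mu> x y) \<and>
        (\<forall>y\<in>dom B. (\<Sum>x\<in>dom A. \<mu> x y) = 1) \<and>
        (\<forall>x\<in>dom A. eff A x = (\<Sum>y\<in>dom B. \<mu> x y *\<^sub>R eff B y)))"

definition compatible :: "'n::finite effects set \<Rightarrow> bool" where
  "compatible \<A> \<longleftrightarrow> (\<exists>C. measurement C \<and> (\<forall>A\<in>\<A>. A \<preceq>\<^sub>p C))"

definition incompatible :: "'n::finite effects set \<Rightarrow> bool" where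
  "incompatible \<A> \<longleftrightarrow> \<not> compatible \<A>"

definition simple :: "'n::finite effects \<Rightarrow> bool" where
  "simple A \<longleftrightarrow>
     (\<forall>x\<in>dom A. \<forall>y\<in>dom A. x \<noteq> y \<longrightarrow> \<not> (\<exists>c::real. 0 \<le> c \<and> eff A x = c *\<^sub>R eff A y))"

text \<open>Simple representatives of a class are unique up to bijective relabeling, so the number of
  outcomes does not depend on the choice made here.\<close>

definition simple_rep :: "'n::finite effects \<Rightarrow> 'n effects" where
  "simple_rep A = (SOME B. measurement B \<and> simple B \<and> A \<preceq>\<^sub>p B \<and> B \<preceq>\<^sub>p A)"

definition num_outcomes :: "'n::finite effects \<Rightarrow> nat" where
  "num_outcomes A = card (dom (simple_rep A))"

definition faithful_state :: "complex^'n^'n \<Rightarrow> bool" where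
  "faithful_state \<rho> \<longleftrightarrow> posdef \<rho> \<and> trace \<rho> = 1"

text \<open>The space \<open>\<complex>^(d^2) = \<complex>^d \<otimes> \<complex>^d\<close> is indexed by pairs, the pair \<open>(j, k)\<close> standing for
  \<open>|j> \<otimes> |k>\<close>; the corresponding coefficient of the vectorization of \<open>E\<close> is \<open><k|E|j>\<close>.\<close>

definition vectorize :: "complex^'n^'n \<Rightarrow> complex^('n \<times> 'n)" where
  "vectorize E = (\<chi> p. E $ snd p $ fst p)"

definition ketbra :: "complex^'m \<Rightarrow> complex^'m^'m" where
  "ketbra v = (\<chi> p q. v $ p * cnj (v $ q))"

text \<open>The trace \<open>tr[\<rho> A\<^sub>x]\<close> is real, since both factors are selfadjoint.\<close>

definition fisher :: "complex^'n^'n \<Rightarrow> 'n::finite effects \<Rightarrow> complex^('n \<times> 'n)^('n \<times> 'n)" where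
  "fisher \<rho> A =
     (\<Sum>x\<in>{x\<in>dom A. trace (\<rho> ** eff A x) \<noteq> 0}.
        (1 / Re (trace (\<rho> ** eff A x))) *\<^sub>R ketbra (vectorize (mat_sqrt \<rho> ** eff A x)))"

text \<open>For a nonempty finite family of selfadjoint matrices the infimum is attained, i.e. is the
  minimum (compactness); for an empty family there is no minimum and the value is meaningless.\<close>

definition height :: "'i set \<Rightarrow> ('i \<Rightarrow> complex^'m^'m) \<Rightarrow> real" where
  "height I X = Inf {Re (trace H) | H. selfadjoint H \<and> (\<forall>i\<in>I. psd (H - X i))}"

end

theory Submission imports Defs begin

text \<open>If \<open>C\<close> is a joint measurement, Cauchy-Schwarz shows that the Fisher information map
  decreases under post-processing, so \<open>F\<^sub>\<rho>(C)\<close> dominates every \<open>F\<^sub>\<rho>(A\<^sup>i)\<close> and the height is at most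
  \<open>tr F\<^sub>\<rho>(C) = \<Sum>\<^sub>y tr(\<rho> C\<^sub>y\<^sup>2) / tr(\<rho> C\<^sub>y)\<close>. Each term is at most \<open>1\<close>, as \<open>C\<^sub>y\<^sup>2 \<le> C\<^sub>y\<close>, and at most \<open>tr C\<^sub>y\<close>, as
  \<open>C\<^sub>y\<^sup>2 \<le> tr(C\<^sub>y) C\<^sub>y\<close>; hence the sum is at most the number of outcomes of \<open>C\<close> and at most \<open>d\<close>.
  Finally, \<open>C\<close> can be taken indexed by tuples of outcomes of the simple representatives.\<close>

section \<open>Adjoints and positive semidefinite forms in the real inner product\<close>

text \<open>Makes the theory of real inner product spaces available: positivity only looks at real
  parts, and these are the values of \<open>inner\<close> on \<open>complex^'n\<close> seen as a
  real space.\<close>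

lemma Re_cinner_vec: "Re (cinner_vec v w) = v \<bullet> w"
  by (simp add: cinner_vec_def inner_vec_def inner_complex_def)

lemma psd_iff_inner: "psd M \<longleftrightarrow> selfadjoint M \<and> (\<forall>v. 0 \<le> v \<bullet> (M *v v))"
  by (simp add: psd_def Re_cinner_vec)

lemma psdD: "psd M \<Longrightarrow> 0 \<le> v \<bullet> (M *v v)" and psd_selfadjoint: "psd M \<Longrightarrow> selfadjoint M"
  by (simp_all add: psd_iff_inner)

lemma posdef_iff_inner:
  "posdef M \<longleftrightarrow> selfadjoint M \<and> (\<forall>v. v \<noteq> 0 \<longrightarrow> 0 < v \<bullet> (M *v v))"
  by (simp add: posdef_def Re_cinner_vec)

lemma dagger_nth [simp]: "dagger M $ i $ j = cnj (M $ j $ i)"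
  by (simp add: dagger_def)

lemma dagger_mult: "dagger (M ** N) = dagger N ** dagger M"
  by (simp add: vec_eq_iff matrix_matrix_mult_def mult.commute)

lemma inner_complex_mult: "(a * b) \<bullet> c = b \<bullet> (cnj a * c)" for a b c :: complex
  by (simp add: inner_complex_def algebra_simps)

lemma inner_dagger: "(M *v v) \<bullet> w = v \<bullet> (dagger M *v w)" for M :: "complex^'n^'m"
proof -
  have "(M *v v) \<bullet> w = (\<Sum>i\<in>UNIV. \<Sum>j\<in>UNIV. v $ j \<bullet> (cnj (M $ i $ j) * w $ i))"
    by (simp add: inner_vec_def matrix_vector_mult_def inner_sum_left inner_complex_mult)
  also have "\<dots> = (\<Sum>j\<in>UNIV. \<Sum>i\<in>UNIV. v $ j \<bullet> (cnj (M $ i $ j) * w $ i))"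
    by (rule sum.swap)
  also have "\<dots> = v \<bullet> (dagger M *v w)"
    by (simp add: inner_vec_def matrix_vector_mult_def inner_sum_right)
  finally show ?thesis .
qed

lemma selfadjoint_inner: "selfadjoint M \<Longrightarrow> (M *v v) \<bullet> w = v \<bullet> (M *v w)"
  by (simp add: inner_dagger selfadjoint_def)

lemma selfadjoint_add: "selfadjoint M \<Longrightarrow> selfadjoint N \<Longrightarrow> selfadjoint (M + N)"
  and selfadjoint_diff: "selfadjoint M \<Longrightarrow> selfadjoint N \<Longrightarrow> selfadjoint (M - N)"
  and selfadjoint_scaleR: "selfadjoint M \<Longrightarrow> selfadjoint (c *\<^sub>R M)"
  and selfadjoint_0: "selfadjoint 0"
  and selfadjoint_mat_1: "selfadjoint (mat 1)"
  and selfadjoint_ketbra: "selfadjoint (ketbra u)"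
  by (auto simp: selfadjoint_def vec_eq_iff mat_def ketbra_def complex_cnj_scaleR)

lemma selfadjoint_square: "selfadjoint M \<Longrightarrow> selfadjoint (M ** M)"
  by (simp add: selfadjoint_def dagger_mult)

lemma selfadjoint_sum: "(\<And>i. i \<in> I \<Longrightarrow> selfadjoint (M i)) \<Longrightarrow> selfadjoint (sum M I)"
  by (induction I rule: infinite_finite_induct) (auto intro: selfadjoint_add selfadjoint_0)

lemma scaleR_matrix_vector_mult: "(c *\<^sub>R M) *v v = c *\<^sub>R (M *v v)" for M :: "complex^'n^'m"
  by (simp add: vec_eq_iff matrix_vector_mult_def scaleR_right.sum)

lemma complex_matrix_vector_mult_scaleR: "M *v (c *\<^sub>R v) = c *\<^sub>R (M *v v)" for M :: "complex^'n^'m"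
  by (simp add: vec_eq_iff matrix_vector_mult_def scaleR_right.sum)

lemma uminus_matrix_vector_mult: "(- M) *v v = - (M *v v)" for M :: "complex^'n^'m"
  by (simp add: vec_eq_iff matrix_vector_mult_def sum_negf)

lemma sum_matrix_vector_mult: "sum M I *v v = (\<Sum>i\<in>I. M i *v v)" for M :: "'i \<Rightarrow> complex^'n^'m"
  by (induction I rule: infinite_finite_induct) (auto simp: matrix_vector_mult_add_rdistrib)

lemma matrix_vector_mult_sum: "M *v sum v I = (\<Sum>i\<in>I. M *v v i)" for M :: "complex^'n^'m"
  by (induction I rule: infinite_finite_induct) (auto simp: matrix_vector_right_distrib)

lemma psd_sum: "(\<And>i. i \<in> I \<Longrightarrow> psd (M i)) \<Longrightarrow> psd (sum M I)"
  by (auto simp: psd_iff_inner sum_matrix_vector_mult inner_sum_right intro: selfadjoint_sum sum_nonneg)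

lemma psd_scaleR: "0 \<le> c \<Longrightarrow> psd M \<Longrightarrow> psd (c *\<^sub>R M)"
  by (auto simp: psd_iff_inner scaleR_matrix_vector_mult intro: selfadjoint_scaleR)

text \<open>The usual discriminant argument on the span of \<open>v\<close> and \<open>w\<close>.
  The form may be degenerate, so \<open>c = 0\<close> is treated separately.\<close>

lemma psd_Cauchy_Schwarz:
  assumes "psd M"
  shows "(v \<bullet> (M *v w))\<^sup>2 \<le> (v \<bullet> (M *v v)) * (w \<bullet> (M *v w))"
proof -
  define a b c where "a = v \<bullet> (M *v v)" and "b = v \<bullet> (M *v w)" and "c = w \<bullet> (M *v w)"
  have sym: "w \<bullet> (M *v v) = b"
    using selfadjoint_inner[OF psd_selfadjoint[OF assms], of v w] by (simp add: b_def inner_commute)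
  have q: "0 \<le> s\<^sup>2 * a + 2 * s * t * b + t\<^sup>2 * c" for s t
    using psdD[OF assms, of "s *\<^sub>R v + t *\<^sub>R w"]
    by (simp add: matrix_vector_right_distrib complex_matrix_vector_mult_scaleR inner_add_left
        inner_add_right sym power2_eq_square algebra_simps flip: a_def b_def c_def)
  have c: "0 \<le> c" unfolding c_def by (rule psdD[OF assms])
  have "b\<^sup>2 \<le> a * c"
  proof (cases "c = 0")
    case True
    have "b = 0"
    proof (rule ccontr)
      assume "b \<noteq> 0"
      \<comment> \<open>For \<open>c = 0\<close> the form is affine in \<open>t\<close>; this
        \<open>t\<close> makes it equal to \<open>-1\<close>.\<close>
      then show False using q[of 1 "- (a + 1) / (2 * b)"] True by (simp add: field_simps)
    qed
    then show ?thesis using True by simp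
  next
    case False
    then have "0 < c" using c by simp
    \<comment> \<open>At \<open>s = c\<close>, \<open>t = - b\<close> the form equals exactly this
      product.\<close>
    moreover have "0 \<le> c * (a * c - b\<^sup>2)"
      using q[of c "- b"] by (simp add: power2_eq_square algebra_simps)
    ultimately show ?thesis by (simp add: zero_le_mult_iff)
  qed
  then show ?thesis by (simp add: a_def b_def c_def)
qed

text \<open>In operator terms, M \<le> t implies M^2 \<le> t M. Cauchy-Schwarz for the form of
  \<open>M\<close> is applied to \<open>v\<close> and \<open>M *v v\<close>, and a factor
  \<open>(norm (M *v v))\<^sup>2\<close> is cancelled.\<close>

lemma psd_norm_square_le:
  assumes "psd M" and "\<And>w. w \<bullet> (M *v w) \<le> t * (norm w)\<^sup>2"
  shows "(norm (M *v v))\<^sup>2 \<le> t * (v \<bullet> (M *v v))"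
proof (cases "M *v v = 0")
  case True
  then show ?thesis by simp
next
  case False
  let ?n = "(norm (M *v v))\<^sup>2"
  have pos: "0 < ?n" using False by simp
  have "v \<bullet> (M *v (M *v v)) = ?n"
    using selfadjoint_inner[OF psd_selfadjoint[OF assms(1)], of v "M *v v"]
    by (simp add: power2_norm_eq_inner)
  then have "?n\<^sup>2 \<le> (v \<bullet> (M *v v)) * ((M *v v) \<bullet> (M *v (M *v v)))"
    using psd_Cauchy_Schwarz[OF assms(1), of v "M *v v"] by simp
  also have "\<dots> \<le> (v \<bullet> (M *v v)) * (t * ?n)"
    by (intro mult_left_mono assms(2) psdD[OF assms(1)])
  finally have "?n * ?n \<le> (t * (v \<bullet> (M *v v))) * ?n"
    by (simp add: power2_eq_square algebra_simps)
  then show ?thesis using pos by (rule mult_right_le_imp_le)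
qed

section \<open>Traces and Hilbert-Schmidt norms\<close>

lemma inner_axis_mult_axis:
  "axis i a \<bullet> (M *v axis i b) = a \<bullet> (M $ i $ i * b)" for M :: "complex^'n^'n"
proof -
  have "(M *v axis i b) $ i = M $ i $ i * b"
    by (simp add: matrix_vector_mult_def axis_def if_distrib cong: if_cong)
  then show ?thesis by (simp add: inner_axis')
qed

lemma Re_trace: "Re (trace M) = (\<Sum>i\<in>UNIV. axis i 1 \<bullet> (M *v axis i 1))"
  for M :: "complex^'n^'n"
  by (simp add: trace_def inner_axis_mult_axis inner_complex_def)

lemma psd_Re_trace_nonneg: "psd M \<Longrightarrow> 0 \<le> Re (trace M)"
  by (auto simp: Re_trace intro!: sum_nonneg psdD)

text \<open>Replaces the spectral bound by the trace. Writing \<open>w\<close> in coordinates,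
  Cauchy-Schwarz for the form bounds the mixed terms by square roots \<open>c i\<close> of diagonal
  entries; the ordinary Cauchy-Schwarz inequality then collects the sum of the
  \<open>(c i)\<^sup>2\<close>, which is the trace.\<close>

lemma psd_inner_le_trace:
  fixes M :: "complex^'n^'n"
  assumes "psd M"
  shows "w \<bullet> (M *v w) \<le> Re (trace M) * (norm w)\<^sup>2"
proof -
  define c where "c i = sqrt (axis i 1 \<bullet> (M *v axis i 1))" for i :: 'n
  have q: "sqrt (axis i (w $ i) \<bullet> (M *v axis i (w $ i))) = cmod (w $ i) * c i" for i
  proof -
    have "axis i (w $ i) \<bullet> (M *v axis i (w $ i))
        = (cmod (w $ i))\<^sup>2 * (axis i 1 \<bullet> (M *v axis i 1))"
      unfolding inner_axis_mult_axis inner_complex_def cmod_power2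
      by (simp add: power2_eq_square algebra_simps)
    then show ?thesis by (simp add: c_def real_sqrt_mult)
  qed
  have w: "w = (\<Sum>i\<in>UNIV. axis i (w $ i))"
    by (simp add: vec_eq_iff axis_def if_distrib cong: if_cong)
  have "w \<bullet> (M *v w) = (\<Sum>i\<in>UNIV. \<Sum>j\<in>UNIV. axis j (w $ j) \<bullet> (M *v axis i (w $ i)))"
    by (subst (1 2) w) (simp add: matrix_vector_mult_sum inner_sum_left inner_sum_right)
  also have "\<dots> \<le> (\<Sum>i\<in>UNIV. \<Sum>j\<in>UNIV. (cmod (w $ j) * c j) * (cmod (w $ i) * c i))"
  proof (intro sum_mono)
    fix i j
    show "axis j (w $ j) \<bullet> (M *v axis i (w $ i)) \<le> (cmod (w $ j) * c j) * (cmod (w $ i) * c i)"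
      using real_le_rsqrt[OF psd_Cauchy_Schwarz[OF assms, of "axis j (w $ j)" "axis i (w $ i)"]]
      by (simp add: real_sqrt_mult q)
  qed
  also have "\<dots> = (\<Sum>i\<in>UNIV. cmod (w $ i) * c i)\<^sup>2"
    by (simp add: power2_eq_square sum_product mult.commute)
  also have "\<dots> \<le> (\<Sum>i\<in>UNIV. (cmod (w $ i))\<^sup>2) * (\<Sum>i\<in>UNIV. (c i)\<^sup>2)"
    by (rule Cauchy_Schwarz_ineq_sum)
  also have "(\<Sum>i\<in>UNIV. (c i)\<^sup>2) = Re (trace M)"
    using psdD[OF assms] by (simp add: c_def Re_trace)
  also have "(\<Sum>i\<in>UNIV. (cmod (w $ i))\<^sup>2) = (norm w)\<^sup>2"
    by (simp add: norm_vec_def L2_set_def sum_nonneg)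
  finally show ?thesis by (simp add: mult.commute)
qed

text \<open>The norm on nested vectors is the Hilbert-Schmidt norm, hence invariant under
  \<open>dagger\<close> and \<open>vectorize\<close> and computable column by column.\<close>

lemma norm_matrix_square: "(norm M)\<^sup>2 = (\<Sum>i\<in>UNIV. \<Sum>j\<in>UNIV. (cmod (M $ i $ j))\<^sup>2)"
  for M :: "complex^'n^'m"
  by (simp add: norm_vec_def L2_set_def sum_nonneg)

lemma norm_matrix_columns: "(norm M)\<^sup>2 = (\<Sum>j\<in>UNIV. (norm (M *v axis j 1))\<^sup>2)"
  for M :: "complex^'n^'m"
proof -
  have "(M *v axis j 1) $ i = M $ i $ j" for i j
    by (simp add: matrix_vector_mult_def axis_def if_distrib cong: if_cong)
  then have "(\<Sum>j\<in>UNIV. (norm (M *v axis j 1))\<^sup>2) = (\<Sum>j\<in>UNIV. \<Sum>i\<in>UNIV. (cmod (M $ i $ j))\<^sup>2)"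
    by (simp add: norm_vec_def L2_set_def sum_nonneg)
  also have "\<dots> = (norm M)\<^sup>2"
    unfolding norm_matrix_square by (rule sum.swap)
  finally show ?thesis by simp
qed

lemma norm_dagger: "norm (dagger M) = norm M"
proof -
  have "(norm (dagger M))\<^sup>2 = (norm M)\<^sup>2"
    unfolding norm_matrix_square by (simp, rule sum.swap)
  then show ?thesis by (simp add: power2_eq_iff_nonneg)
qed

lemma norm_vectorize: "norm (vectorize E) = norm E"
proof -
  have "(norm (vectorize E))\<^sup>2 = (\<Sum>p\<in>UNIV \<times> UNIV. (cmod (E $ snd p $ fst p))\<^sup>2)"
    by (simp add: norm_vec_def L2_set_def sum_nonneg vectorize_def)
  also have "\<dots> = (\<Sum>j\<in>UNIV. \<Sum>k\<in>UNIV. (cmod (E $ k $ j))\<^sup>2)"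
    by (simp add: sum.cartesian_product case_prod_beta)
  also have "\<dots> = (norm E)\<^sup>2"
    unfolding norm_matrix_square by (rule sum.swap)
  finally show ?thesis by (simp add: power2_eq_iff_nonneg)
qed

section \<open>The square root of a faithful state\<close>

text \<open>For D = R - S the hypothesis gives R D = - D S, so tr(D R D) = - tr(D S D). Both traces
  are nonnegative, hence zero; then \<open>R\<close> annihilates the columns of \<open>D\<close>,
  and definiteness of \<open>R ** R\<close> leaves only D = 0.\<close>

lemma psd_square_root_unique:
  fixes R S :: "complex^'n^'n"
  assumes R: "psd R" and S: "psd S" and eq: "R ** R = S ** S" and pos: "posdef (R ** R)"
  shows "R = S"
proof -
  define D where "D = R - S"
  have D: "selfadjoint D"
    unfolding D_def by (intro selfadjoint_diff psd_selfadjoint R S)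
  have RD: "R *v (D *v v) = - (D *v (S *v v))" for v
    using arg_cong[OF eq, of "\<lambda>M. M *v v"]
    by (simp add: D_def matrix_vector_mult_diff_rdistrib matrix_vector_mult_diff_distrib
        flip: matrix_vector_mul_assoc)
  let ?e = "\<lambda>i. axis i 1 :: complex^'n"
  \<comment> \<open>Sums of form values over the columns of \<open>D\<close> become traces, to which
    cyclicity applies.\<close>
  have t: "(\<Sum>i\<in>UNIV. (D *v ?e i) \<bullet> (M *v (D *v ?e i))) = Re (trace (D ** (M ** D)))"
    for M :: "complex^'n^'n"
    by (simp add: Re_trace selfadjoint_inner[OF D] flip: matrix_vector_mul_assoc)
  have "R ** D = - (D ** S)"
    by (simp add: matrix_eq RD uminus_matrix_vector_mult flip: matrix_vector_mul_assoc)
  then have "trace (D ** (R ** D)) = trace (D ** (- (D ** S)))" by simp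
  also have "\<dots> = - trace (D ** (D ** S))"
    by (simp add: trace_def matrix_matrix_mult_def sum_negf)
  also have "trace (D ** (D ** S)) = trace (D ** (S ** D))"
    by (metis matrix_mul_assoc trace_mul_sym)
  finally have "(\<Sum>i\<in>UNIV. (D *v ?e i) \<bullet> (R *v (D *v ?e i)))
      = - (\<Sum>i\<in>UNIV. (D *v ?e i) \<bullet> (S *v (D *v ?e i)))"
    unfolding t by simp
  moreover have "0 \<le> (\<Sum>i\<in>UNIV. (D *v ?e i) \<bullet> (S *v (D *v ?e i)))"
    by (intro sum_nonneg psdD S)
  ultimately have "(\<Sum>i\<in>UNIV. (D *v ?e i) \<bullet> (R *v (D *v ?e i))) = 0"
    using sum_nonneg[of UNIV "\<lambda>i. (D *v ?e i) \<bullet> (R *v (D *v ?e i))"] psdD[OF R] by force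
  then have z: "(D *v ?e i) \<bullet> (R *v (D *v ?e i)) = 0" for i
    using psdD[OF R] by (subst (asm) sum_nonneg_eq_0_iff) auto
  have "D *v ?e i = 0" for i
  proof (rule ccontr)
    assume n: "D *v ?e i \<noteq> 0"
    have "(norm (R *v (D *v ?e i)))\<^sup>2 \<le> Re (trace R) * ((D *v ?e i) \<bullet> (R *v (D *v ?e i)))"
      by (intro psd_norm_square_le R psd_inner_le_trace)
    then have "R *v (D *v ?e i) = 0" by (simp add: z)
    then show False
      using pos n unfolding posdef_iff_inner
      by (metis matrix_vector_mul_assoc matrix_vector_mult_0_right inner_zero_right less_irrefl)
  qed
  then have "(norm D)\<^sup>2 = 0" unfolding norm_matrix_columns by simp
  then show ?thesis by (simp add: D_def)
qed

text \<open>The constant is the minimum of the form on the compact unit sphere; homogeneity extends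
  the bound to all vectors.\<close>

lemma posdef_lower_bound:
  fixes M :: "complex^'n^'n"
  assumes "posdef M"
  obtains c where "0 < c" "\<And>v. c * (norm v)\<^sup>2 \<le> v \<bullet> (M *v v)"
proof -
  have "continuous_on (sphere 0 1) (\<lambda>v. v \<bullet> (M *v v))"
    by (intro continuous_intros linear_continuous_on linear_linear[THEN iffD2] linearI)
      (auto simp: matrix_vector_right_distrib complex_matrix_vector_mult_scaleR)
  moreover have "(sphere 0 1 :: (complex^'n) set) \<noteq> {}" by simp
  ultimately have "\<exists>u\<in>sphere 0 1. \<forall>v\<in>sphere 0 1. u \<bullet> (M *v u) \<le> v \<bullet> (M *v v)"
    by (intro continuous_attains_inf compact_sphere)
  then obtain u where u: "u \<in> sphere 0 1"
    and le: "\<And>v. v \<in> sphere 0 1 \<Longrightarrow> u \<bullet> (M *v u) \<le> v \<bullet> (M *v v)"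
    by blast
  show ?thesis
  proof
    have "u \<noteq> 0" using u by auto
    then show "0 < u \<bullet> (M *v u)" using assms by (simp add: posdef_iff_inner)
    fix v
    show "u \<bullet> (M *v u) * (norm v)\<^sup>2 \<le> v \<bullet> (M *v v)"
    proof (cases "v = 0")
      case False
      then have "u \<bullet> (M *v u) \<le> (v /\<^sub>R norm v) \<bullet> (M *v (v /\<^sub>R norm v))" by (intro le) simp
      then show ?thesis using False
        by (simp add: complex_matrix_vector_mult_scaleR power2_eq_square field_simps)
    qed simp
  qed
qed

text \<open>Left multiplication acts on each column separately, so an operator norm bound on
  \<open>Y\<close> carries over to Hilbert-Schmidt norms.\<close>

lemma norm_mult_le_left:
  fixes Y D :: "complex^'n^'n"
  assumes "\<And>v. norm (Y *v v) \<le> q * norm v" "0 \<le> q"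
  shows "norm (Y ** D) \<le> q * norm D"
proof (rule power2_le_imp_le)
  have "(norm (Y ** D))\<^sup>2 = (\<Sum>j\<in>UNIV. (norm (Y *v (D *v axis j 1)))\<^sup>2)"
    by (simp add: norm_matrix_columns matrix_vector_mul_assoc)
  also have "\<dots> \<le> (\<Sum>j\<in>UNIV. (q * norm (D *v axis j 1))\<^sup>2)"
    by (intro sum_mono power_mono assms) auto
  also have "\<dots> = (q * norm D)\<^sup>2"
    by (simp add: power_mult_distrib norm_matrix_columns sum_distrib_left)
  finally show "(norm (Y ** D))\<^sup>2 \<le> (q * norm D)\<^sup>2" .
qed (use assms in simp)

text \<open>If \<open>Y = (1 - M + Y\<^sup>2) / 2\<close> then \<open>(1 - Y)\<^sup>2 = M\<close>, and the right-hand side is a contraction of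
  the selfadjoint matrices of operator norm at most \<open>q = \<parallel>1 - M\<parallel> < 1\<close>.\<close>

lemma psd_square_root_exists:
  fixes M :: "complex^'n^'n"
  assumes M: "posdef M" and M1: "psd (mat 1 - M)"
  shows "\<exists>R. psd R \<and> R ** R = M"
proof -
  obtain c where c: "0 < c" "\<And>v. c * (norm v)\<^sup>2 \<le> v \<bullet> (M *v v)"
    using posdef_lower_bound[OF M] by blast
  define B where "B = mat 1 - M"
  \<comment> \<open>The lower bound \<open>c\<close> for \<open>M\<close> becomes the upper bound
    \<open>q < 1\<close> for \<open>B\<close>, which serves as contraction factor.\<close>
  define q where "q = 1 - c"
  have Bq: "w \<bullet> (B *v w) \<le> q * (norm w)\<^sup>2" for w
    using c(2)[of w] by (simp add: B_def q_def matrix_vector_mult_diff_rdistrib inner_diff_right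
        power2_norm_eq_inner algebra_simps)
  have q1: "q < 1" using c(1) by (simp add: q_def)
  have q0: "0 \<le> q"
  proof -
    \<comment> \<open>Any unit vector serves here: the form of \<open>B\<close> at it lies between 0
      and \<open>q\<close>.\<close>
    have "0 \<le> axis undefined 1 \<bullet> (B *v axis undefined 1)"
      using psdD[OF M1] by (simp add: B_def)
    also have "\<dots> \<le> q * (norm (axis undefined (1::complex) :: complex^'n))\<^sup>2" by (rule Bq)
    finally show ?thesis by (simp add: norm_axis_1)
  qed
  have Bn: "norm (B *v v) \<le> q * norm v" for v
  proof (rule power2_le_imp_le)
    have "(norm (B *v v))\<^sup>2 \<le> q * (v \<bullet> (B *v v))"
      using M1 Bq by (intro psd_norm_square_le) (simp_all add: B_def)
    also have "\<dots> \<le> q * (q * (norm v)\<^sup>2)" by (intro mult_left_mono Bq q0)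
    finally show "(norm (B *v v))\<^sup>2 \<le> (q * norm v)\<^sup>2" by (simp add: power2_eq_square algebra_simps)
  qed (use q0 in simp)
  define S where "S = {Y :: complex^'n^'n. selfadjoint Y \<and> (\<forall>v. norm (Y *v v) \<le> q * norm v)}"
  define f where "f Y = (1/2) *\<^sub>R (B + Y ** Y)" for Y
  have cont: "continuous_on UNIV (\<lambda>Y :: complex^'n^'n. Y *v v)" for v
    by (intro linear_continuous_on linear_linear[THEN iffD2] linearI)
      (auto simp: matrix_vector_mult_add_rdistrib scaleR_matrix_vector_mult)
  have contd: "continuous_on UNIV (dagger :: complex^'n^'n \<Rightarrow> _)"
    unfolding dagger_def by (intro continuous_intros)
  have "closed S"
    unfolding S_def selfadjoint_def
    by (intro closed_Collect_conj closed_Collect_all closed_Collect_le closed_Collect_eq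
        continuous_intros cont contd)
  then have "complete S" by (simp add: complete_eq_closed)
  moreover have "S \<noteq> {}"
    using q0 by (auto simp: S_def selfadjoint_0 intro!: exI[of _ 0])
  moreover have "f ` S \<subseteq> S"
  proof clarify
    fix Y assume Y: "Y \<in> S"
    have "selfadjoint (f Y)"
      using Y psd_selfadjoint[OF M1] unfolding f_def S_def B_def
      by (auto intro!: selfadjoint_scaleR selfadjoint_add selfadjoint_square)
    moreover have "norm (f Y *v v) \<le> q * norm v" for v
    proof -
      have "norm (Y *v (Y *v v)) \<le> q * norm (Y *v v)" using Y by (simp add: S_def)
      also have "\<dots> \<le> 1 * norm (Y *v v)" using q1 by (intro mult_right_mono) auto
      also have "\<dots> \<le> q * norm v" using Y by (simp add: S_def)
      finally have "norm (B *v v + Y *v (Y *v v)) \<le> q * norm v + q * norm v"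
        using norm_triangle_ineq[of "B *v v" "Y *v (Y *v v)"] Bn[of v] by linarith
      then show ?thesis
        by (simp add: f_def scaleR_matrix_vector_mult matrix_vector_mult_add_rdistrib
            matrix_vector_mul_assoc)
    qed
    ultimately show "f Y \<in> S" by (simp add: S_def)
  qed
  moreover have "dist (f Y) (f Z) \<le> q * dist Y Z" if Y: "Y \<in> S" and Z: "Z \<in> S" for Y Z
  proof -
    define D where "D = Y - Z"
    \<comment> \<open>The noncommutative difference of squares, Y^2 - Z^2 = Y D + D Z.\<close>
    have e: "f Y - f Z = (1/2) *\<^sub>R (Y ** D + D ** Z)"
      by (simp add: f_def D_def matrix_eq scaleR_matrix_vector_mult matrix_vector_mult_diff_rdistrib
          matrix_vector_mult_add_rdistrib matrix_vector_mult_diff_distrib algebra_simps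
          flip: matrix_vector_mul_assoc)
    have "norm (Y ** D) \<le> q * norm D"
      using Y q0 by (intro norm_mult_le_left) (auto simp: S_def)
    moreover have "norm (D ** Z) \<le> q * norm D"
    proof -
      \<comment> \<open>Taking adjoints reduces right multiplication by \<open>Z\<close> to the left
        multiplication bound.\<close>
      have "norm (D ** Z) = norm (Z ** dagger D)"
        using Z by (subst norm_dagger[symmetric]) (simp add: dagger_mult S_def selfadjoint_def)
      also have "\<dots> \<le> q * norm (dagger D)"
        using Z q0 by (intro norm_mult_le_left) (auto simp: S_def)
      finally show ?thesis by (simp add: norm_dagger)
    qed
    ultimately have "norm (Y ** D + D ** Z) \<le> 2 * q * norm D"
      using norm_triangle_ineq[of "Y ** D" "D ** Z"] by linarith
    then show ?thesis by (simp add: dist_norm e) (simp add: D_def)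
  qed
  ultimately obtain Y where Y: "Y \<in> S" "f Y = Y"
    using Banach_fix[of S q f] q0 q1 by blast
  have "(mat 1 - Y) ** (mat 1 - Y) = M"
  proof -
    have "B + Y ** Y = Y + Y"
      using arg_cong[OF Y(2), of "\<lambda>Z. 2 *\<^sub>R Z"] by (simp add: f_def scaleR_2)
    then have "Y ** Y = Y + Y - B" by (simp add: eq_diff_eq add.commute)
    moreover have "(mat 1 - Y) ** (mat 1 - Y) = mat 1 - Y - (Y - Y ** Y)"
      by (simp only: matrix_eq matrix_vector_mult_diff_rdistrib matrix_vector_mult_diff_distrib
          matrix_vector_mul_lid simp_thms flip: matrix_vector_mul_assoc)
    ultimately show ?thesis by (simp add: B_def)
  qed
  moreover have "psd (mat 1 - Y)"
    unfolding psd_iff_inner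
  proof (intro conjI allI)
    show "selfadjoint (mat 1 - Y)"
      using Y by (auto simp: S_def intro: selfadjoint_diff selfadjoint_mat_1)
    fix v
    have "v \<bullet> (Y *v v) \<le> norm v * norm (Y *v v)" by (rule norm_cauchy_schwarz)
    also have "\<dots> \<le> norm v * (q * norm v)" using Y by (intro mult_left_mono) (auto simp: S_def)
    also have "\<dots> \<le> norm v * (1 * norm v)" using q1 by (intro mult_left_mono mult_right_mono) auto
    finally show "0 \<le> v \<bullet> ((mat 1 - Y) *v v)"
      by (simp add: matrix_vector_mult_diff_rdistrib inner_diff_right dot_square_norm
          power2_eq_square)
  qed
  ultimately show ?thesis by blast
qed

lemma posdef_imp_psd: "posdef M \<Longrightarrow> psd M"
  unfolding posdef_iff_inner psd_iff_inner
  by (metis inner_zero_left less_eq_real_def)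

text \<open>Since \<open>mat_sqrt\<close> is a definite description, existence and uniqueness must
  both be supplied. Trace 1 yields \<rho> \<le> 1, the normalization assumed in
  \<open>psd_square_root_exists\<close>.\<close>

lemma mat_sqrt_faithful_state:
  assumes "faithful_state \<rho>"
  shows "psd (mat_sqrt \<rho>)" and "mat_sqrt \<rho> ** mat_sqrt \<rho> = \<rho>"
proof -
  have pos: "posdef \<rho>" and tr: "trace \<rho> = 1" using assms by (auto simp: faithful_state_def)
  have "psd (mat 1 - \<rho>)"
    unfolding psd_iff_inner
    using pos psd_inner_le_trace[OF posdef_imp_psd[OF pos]]
    by (auto simp: tr posdef_iff_inner matrix_vector_mult_diff_rdistrib inner_diff_right
        dot_square_norm intro: selfadjoint_diff selfadjoint_mat_1)
  then obtain R where "psd R \<and> R ** R = \<rho>" using psd_square_root_exists[OF pos] by blast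
  then have "\<exists>!R. psd R \<and> R ** R = \<rho>" using psd_square_root_unique pos by metis
  then have "psd (mat_sqrt \<rho>) \<and> mat_sqrt \<rho> ** mat_sqrt \<rho> = \<rho>"
    unfolding mat_sqrt_def by (rule theI')
  then show "psd (mat_sqrt \<rho>)" "mat_sqrt \<rho> ** mat_sqrt \<rho> = \<rho>" by auto
qed

section \<open>The trace of the Fisher information map\<close>

text \<open>The index type is arbitrary instead of \<open>int\<close>, so that outcomes can be
  tuples, encoded as functions.\<close>

definition povm :: "'j set \<Rightarrow> ('j \<Rightarrow> complex^'n^'n) \<Rightarrow> bool" where
  "povm J E \<longleftrightarrow> finite J \<and> (\<forall>y\<in>J. psd (E y)) \<and> sum E J = mat 1"

definition fisher_sum ::
  "complex^'n^'n \<Rightarrow> 'j set \<Rightarrow> ('j \<Rightarrow> complex^'n^'n) \<Rightarrow> complex^('n \<times> 'n)^('n \<times> 'n)" where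
  "fisher_sum \<rho> J E =
     (\<Sum>y\<in>J. (1 / Re (trace (\<rho> ** E y))) *\<^sub>R ketbra (vectorize (mat_sqrt \<rho> ** E y)))"

text \<open>The terms omitted in \<^const>\<open>fisher\<close> vanish anyway, because \<open>1 / 0 = 0\<close>.\<close>

lemma fisher_eq_fisher_sum: "finite (dom A) \<Longrightarrow> fisher \<rho> A = fisher_sum \<rho> (dom A) (eff A)"
  unfolding fisher_def fisher_sum_def by (rule sum.mono_neutral_left) auto

lemma Re_trace_weighted_sum:
  "Re (trace (\<Sum>y\<in>J. c y *\<^sub>R M y)) = (\<Sum>y\<in>J. c y * Re (trace (M y)))"
  for M :: "'j \<Rightarrow> complex^'n^'n"
  by (simp add: Re_trace sum_matrix_vector_mult inner_sum_right scaleR_matrix_vector_mult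
      sum_distrib_left) (rule sum.swap)

lemma trace_ketbra: "Re (trace (ketbra u)) = (norm u)\<^sup>2"
  by (simp add: trace_def ketbra_def norm_vec_def L2_set_def sum_nonneg cmod_power2)
    (simp add: power2_eq_square)

lemma inner_ketbra: "v \<bullet> (ketbra u *v v) = (cmod (cinner_vec v u))\<^sup>2"
proof -
  have "ketbra u *v v = (\<chi> i. u $ i * cinner_vec u v)"
    by (simp add: vec_eq_iff matrix_vector_mult_def ketbra_def cinner_vec_def sum_distrib_left
        mult.assoc)
  moreover have "cinner_vec u v = cnj (cinner_vec v u)"
    by (simp add: cinner_vec_def mult.commute)
  moreover have "cinner_vec v (\<chi> i. u $ i * c) = cinner_vec v u * c" for c
    by (simp add: cinner_vec_def sum_distrib_right mult.assoc)
  ultimately show ?thesis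
    unfolding Re_cinner_vec[symmetric] by (simp add: complex_mult_cnj cmod_power2)
qed

lemma inner_fisher_sum:
  "v \<bullet> (fisher_sum \<rho> J E *v v) =
    (\<Sum>y\<in>J. (cmod (cinner_vec v (vectorize (mat_sqrt \<rho> ** E y))))\<^sup>2 / Re (trace (\<rho> ** E y)))"
  by (simp add: fisher_sum_def sum_matrix_vector_mult scaleR_matrix_vector_mult inner_sum_right
      inner_ketbra)

lemma selfadjoint_fisher_sum: "selfadjoint (fisher_sum \<rho> J E)"
  unfolding fisher_sum_def by (intro selfadjoint_sum selfadjoint_scaleR selfadjoint_ketbra)

text \<open>With R the root of \<rho>, cyclicity turns tr(R R E) into tr(R E R), a sum of values of
  the form of \<open>E\<close>. Positivity and bounds on \<open>E\<close> can then be used term by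
  term.\<close>

lemma Re_trace_state_mult:
  assumes "faithful_state \<rho>"
  shows "Re (trace (\<rho> ** E)) =
    (\<Sum>j\<in>UNIV. (mat_sqrt \<rho> *v axis j 1) \<bullet> (E *v (mat_sqrt \<rho> *v axis j 1)))"
proof -
  let ?R = "mat_sqrt \<rho>"
  have "trace (\<rho> ** E) = trace (?R ** (?R ** E))"
    by (simp add: matrix_mul_assoc mat_sqrt_faithful_state[OF assms])
  also have "\<dots> = trace (?R ** (E ** ?R))"
    by (metis matrix_mul_assoc trace_mul_sym)
  finally show ?thesis
    by (simp add: Re_trace selfadjoint_inner[OF psd_selfadjoint[OF mat_sqrt_faithful_state(1)[OF assms]]]
        flip: matrix_vector_mul_assoc)
qed

lemma Re_trace_state_mult_nonneg:
  "faithful_state \<rho> \<Longrightarrow> psd E \<Longrightarrow> 0 \<le> Re (trace (\<rho> ** E))"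
  by (auto simp: Re_trace_state_mult intro!: sum_nonneg psdD)

text \<open>The left side is tr(\<rho> E^2). Passing to the adjoint E R, its columns are
  \<open>E\<close> applied to vectors, where E^2 \<le> t E is available.\<close>

lemma norm_vectorize_sqrt_mult_le:
  assumes \<rho>: "faithful_state \<rho>" and E: "psd E" and t: "\<And>w. w \<bullet> (E *v w) \<le> t * (norm w)\<^sup>2"
  shows "(norm (vectorize (mat_sqrt \<rho> ** E)))\<^sup>2 \<le> t * Re (trace (\<rho> ** E))"
proof -
  let ?R = "mat_sqrt \<rho>"
  have "norm (vectorize (?R ** E)) = norm (dagger (?R ** E))"
    by (simp add: norm_vectorize norm_dagger)
  also have "dagger (?R ** E) = E ** ?R"
    using psd_selfadjoint[OF E] psd_selfadjoint[OF mat_sqrt_faithful_state(1)[OF \<rho>]]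
    by (simp add: dagger_mult selfadjoint_def)
  finally have "(norm (vectorize (?R ** E)))\<^sup>2 = (\<Sum>j\<in>UNIV. (norm (E *v (?R *v axis j 1)))\<^sup>2)"
    by (simp add: norm_matrix_columns matrix_vector_mul_assoc)
  also have "\<dots> \<le> (\<Sum>j\<in>UNIV. t * ((?R *v axis j 1) \<bullet> (E *v (?R *v axis j 1))))"
    by (intro sum_mono psd_norm_square_le E t)
  finally show ?thesis by (simp add: Re_trace_state_mult[OF \<rho>] sum_distrib_left)
qed

text \<open>A common form of the two estimates: \<open>t y\<close> is any scalar dominating the
  effect \<open>E y\<close>, later either its trace or 1.\<close>

lemma Re_trace_fisher_sum_le:
  assumes \<rho>: "faithful_state \<rho>" and E: "\<And>y. y \<in> J \<Longrightarrow> psd (E y)"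
    and t0: "\<And>y. y \<in> J \<Longrightarrow> 0 \<le> t y"
    and t: "\<And>y w. y \<in> J \<Longrightarrow> w \<bullet> (E y *v w) \<le> t y * (norm w)\<^sup>2"
  shows "Re (trace (fisher_sum \<rho> J E)) \<le> sum t J"
  unfolding fisher_sum_def Re_trace_weighted_sum trace_ketbra
proof (rule sum_mono)
  fix y assume y: "y \<in> J"
  show "1 / Re (trace (\<rho> ** E y)) * (norm (vectorize (mat_sqrt \<rho> ** E y)))\<^sup>2 \<le> t y"
  \<comment> \<open>For a zero denominator the left side is 0 by \<open>1 / 0 = 0\<close>, and
    \<open>t y\<close> is nonnegative.\<close>
  proof (cases "Re (trace (\<rho> ** E y)) = 0")
    case False
    then have "0 < Re (trace (\<rho> ** E y))"
      using Re_trace_state_mult_nonneg[OF \<rho> E[OF y]] by simp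
    then show ?thesis
      using norm_vectorize_sqrt_mult_le[OF \<rho> E[OF y] t[OF y]] by (simp add: field_simps)
  qed (simp add: t0 y)
qed

lemma Re_trace_fisher_povm_le:
  fixes E :: "'j \<Rightarrow> complex^'n^'n"
  assumes \<rho>: "faithful_state \<rho>" and E: "povm J E"
  shows "Re (trace (fisher_sum \<rho> J E)) \<le> real (min CARD('n) (card J))"
proof -
  have psd: "\<And>y. y \<in> J \<Longrightarrow> psd (E y)" and fin: "finite J" and one: "sum E J = mat 1"
    using E by (auto simp: povm_def)
  \<comment> \<open>Dominating each effect by its trace gives the dimension, because the effects sum
    to the identity.\<close>
  have "Re (trace (fisher_sum \<rho> J E)) \<le> (\<Sum>y\<in>J. Re (trace (E y)))"
    by (intro Re_trace_fisher_sum_le \<rho> psd psd_Re_trace_nonneg psd_inner_le_trace)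
  also have "\<dots> = Re (trace (mat 1 :: complex^'n^'n))"
    using Re_trace_weighted_sum[of "\<lambda>_. 1" E J] by (simp add: one)
  also have "\<dots> = real CARD('n)" by (simp add: trace_def mat_def)
  finally have 1: "Re (trace (fisher_sum \<rho> J E)) \<le> real CARD('n)" .
  \<comment> \<open>Each effect is below the identity, the others being positive; the constant 1
    then counts outcomes.\<close>
  have "w \<bullet> (E y *v w) \<le> 1 * (norm w)\<^sup>2" if "y \<in> J" for y w
  proof -
    have "w \<bullet> (E y *v w) \<le> (\<Sum>y\<in>J. w \<bullet> (E y *v w))"
      by (rule member_le_sum) (use that fin psd in \<open>auto intro: psdD\<close>)
    also have "\<dots> = w \<bullet> (sum E J *v w)" by (simp add: sum_matrix_vector_mult inner_sum_right)
    finally show ?thesis by (simp add: one power2_norm_eq_inner)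
  qed
  then have "Re (trace (fisher_sum \<rho> J E)) \<le> (\<Sum>y\<in>J. 1)"
    by (intro Re_trace_fisher_sum_le \<rho> psd) auto
  with 1 show ?thesis by simp
qed

section \<open>Monotonicity of Fisher information under post-processing\<close>

text \<open>Subadditivity of the perspective function |a|^2 / p, with weights. The condition that
  \<open>a y\<close> vanish together with \<open>p y\<close> excludes terms which
  \<open>x / 0 = 0\<close> would wrongly discard.\<close>

lemma weighted_Cauchy_Schwarz:
  fixes a :: "'j \<Rightarrow> 'a::real_normed_vector"
  assumes m: "\<And>y. y \<in> J \<Longrightarrow> 0 \<le> m y" and p: "\<And>y. y \<in> J \<Longrightarrow> 0 \<le> p y"
    and a: "\<And>y. y \<in> J \<Longrightarrow> p y = 0 \<Longrightarrow> a y = 0"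
  shows "(norm (\<Sum>y\<in>J. m y *\<^sub>R a y))\<^sup>2 / (\<Sum>y\<in>J. m y * p y)
      \<le> (\<Sum>y\<in>J. m y * ((norm (a y))\<^sup>2 / p y))"
proof -
  have "norm (\<Sum>y\<in>J. m y *\<^sub>R a y) \<le> (\<Sum>y\<in>J. m y * norm (a y))"
    by (rule sum_norm_le) (simp add: m)
  also have "\<dots> = (\<Sum>y\<in>J. (sqrt (m y) * (norm (a y) / sqrt (p y))) * (sqrt (m y) * sqrt (p y)))"
  proof (rule sum.cong)
    fix y assume y: "y \<in> J"
    have "m y = sqrt (m y) * sqrt (m y)" using m[OF y] by simp
    then show "m y * norm (a y)
        = (sqrt (m y) * (norm (a y) / sqrt (p y))) * (sqrt (m y) * sqrt (p y))"
      using a[OF y] by (cases "p y = 0") simp_all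
  qed simp
  finally have "(norm (\<Sum>y\<in>J. m y *\<^sub>R a y))\<^sup>2
      \<le> (\<Sum>y\<in>J. (sqrt (m y) * (norm (a y) / sqrt (p y))) * (sqrt (m y) * sqrt (p y)))\<^sup>2"
    by (intro power_mono) auto
  also have "\<dots> \<le> (\<Sum>y\<in>J. (sqrt (m y) * (norm (a y) / sqrt (p y)))\<^sup>2)
      * (\<Sum>y\<in>J. (sqrt (m y) * sqrt (p y))\<^sup>2)"
    by (rule Cauchy_Schwarz_ineq_sum)
  also have "\<dots> = (\<Sum>y\<in>J. m y * ((norm (a y))\<^sup>2 / p y)) * (\<Sum>y\<in>J. m y * p y)"
    using m p by (simp add: power_mult_distrib power_divide)
  finally have le: "(norm (\<Sum>y\<in>J. m y *\<^sub>R a y))\<^sup>2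
      \<le> (\<Sum>y\<in>J. m y * ((norm (a y))\<^sup>2 / p y)) * (\<Sum>y\<in>J. m y * p y)" .
  have nonneg: "0 \<le> (\<Sum>y\<in>J. m y * p y)" "0 \<le> (\<Sum>y\<in>J. m y * ((norm (a y))\<^sup>2 / p y))"
    using m p by (auto intro!: sum_nonneg)
  show ?thesis
  proof (cases "(\<Sum>y\<in>J. m y * p y) = 0")
    case False
    then show ?thesis using le nonneg by (simp add: pos_divide_le_eq)
  qed (use nonneg in simp)
qed

text \<open>At a fixed \<open>v\<close> both forms are sums of |L|^2 / P with \<open>L\<close> and
  \<open>P\<close> real-linear in the effect. The weighted Cauchy-Schwarz inequality applies for
  each outcome \<open>x\<close>, and summing over \<open>x\<close> removes the weights because the
  columns of \<open>m\<close> sum to 1.\<close>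

lemma fisher_sum_mono:
  assumes \<rho>: "faithful_state \<rho>" and E: "\<And>y. y \<in> J \<Longrightarrow> psd (E y)"
    and m0: "\<And>x y. x \<in> I \<Longrightarrow> y \<in> J \<Longrightarrow> 0 \<le> m x y"
    and m1: "\<And>y. y \<in> J \<Longrightarrow> (\<Sum>x\<in>I. m x y) = 1"
    and F: "\<And>x. x \<in> I \<Longrightarrow> F x = (\<Sum>y\<in>J. m x y *\<^sub>R E y)"
  shows "psd (fisher_sum \<rho> J E - fisher_sum \<rho> I F)"
  unfolding psd_iff_inner
proof (intro conjI allI)
  show "selfadjoint (fisher_sum \<rho> J E - fisher_sum \<rho> I F)"
    by (intro selfadjoint_diff selfadjoint_fisher_sum)
  fix v
  define L where "L M = cinner_vec v (vectorize (mat_sqrt \<rho> ** M))" for M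
  define P where "P M = Re (trace (\<rho> ** M))" for M
  have linL: "linear L"
    unfolding L_def
    by (rule linearI) (simp_all add: matrix_add_ldistrib vectorize_def cinner_vec_def
        matrix_matrix_mult_def distrib_left sum.distrib flip: scaleR_sum_right)
  have linP: "linear P"
    unfolding P_def
    by (rule linearI) (simp_all add: matrix_add_ldistrib trace_def
        matrix_matrix_mult_def distrib_left sum.distrib scaleR_right.sum sum_distrib_left)
  have P0: "0 \<le> P (E y)" if "y \<in> J" for y
    using that unfolding P_def by (intro Re_trace_state_mult_nonneg \<rho> E)
  \<comment> \<open>An outcome of probability zero has vanishing vector, by the bound tr(\<rho> E^2)
    \<le> tr(E) tr(\<rho> E).\<close>
  have L0: "L (E y) = 0" if "y \<in> J" "P (E y) = 0" for y
  proof -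
    have "(norm (vectorize (mat_sqrt \<rho> ** E y)))\<^sup>2 \<le> Re (trace (E y)) * P (E y)"
      unfolding P_def by (intro norm_vectorize_sqrt_mult_le psd_inner_le_trace \<rho> E that)
    then have "vectorize (mat_sqrt \<rho> ** E y) = 0" by (simp add: that)
    then show ?thesis by (simp add: L_def cinner_vec_def)
  qed
  have "v \<bullet> (fisher_sum \<rho> I F *v v) = (\<Sum>x\<in>I. (cmod (L (F x)))\<^sup>2 / P (F x))"
    by (simp add: inner_fisher_sum L_def P_def)
  also have "\<dots> = (\<Sum>x\<in>I. (cmod (\<Sum>y\<in>J. m x y *\<^sub>R L (E y)))\<^sup>2 / (\<Sum>y\<in>J. m x y * P (E y)))"
    by (intro sum.cong) (simp_all add: F linear_sum[OF linL] linear_sum[OF linP]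
        linear_scale[OF linL] linear_scale[OF linP])
  also have "\<dots> \<le> (\<Sum>x\<in>I. \<Sum>y\<in>J. m x y * ((cmod (L (E y)))\<^sup>2 / P (E y)))"
    by (intro sum_mono weighted_Cauchy_Schwarz m0 P0 L0)
  also have "\<dots> = (\<Sum>y\<in>J. \<Sum>x\<in>I. m x y * ((cmod (L (E y)))\<^sup>2 / P (E y)))"
    by (rule sum.swap)
  also have "\<dots> = (\<Sum>y\<in>J. (cmod (L (E y)))\<^sup>2 / P (E y))"
    unfolding sum_distrib_right[symmetric] by (simp add: m1)
  also have "\<dots> = v \<bullet> (fisher_sum \<rho> J E *v v)"
    by (simp add: inner_fisher_sum L_def P_def)
  finally show "0 \<le> v \<bullet> ((fisher_sum \<rho> J E - fisher_sum \<rho> I F) *v v)"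
    by (simp add: matrix_vector_mult_diff_rdistrib inner_diff_right)
qed

section \<open>Height\<close>

lemma height_le:
  assumes "i \<in> I" and "selfadjoint H" and "\<And>i. i \<in> I \<Longrightarrow> psd (H - X i)"
  shows "height I X \<le> Re (trace H)"
  unfolding height_def
proof (rule cInf_lower)
  \<comment> \<open>Any member of the family bounds all admissible traces from below; this is where
    the index \<open>i\<close> enters.\<close>
  show "bdd_below {Re (trace H) | H. selfadjoint H \<and> (\<forall>i\<in>I. psd (H - X i))}"
  proof (rule bdd_belowI)
    fix t assume "t \<in> {Re (trace H) | H. selfadjoint H \<and> (\<forall>i\<in>I. psd (H - X i))}"
    then obtain K where "t = Re (trace K)" "psd (K - X i)" using assms(1) by auto
    then show "Re (trace (X i)) \<le> t"
      using psd_Re_trace_nonneg[of "K - X i"] by (simp add: trace_sub)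
  qed
qed (use assms in auto)

section \<open>The post-processing preorder and simple representatives\<close>

lemma postproc_refl:
  assumes "finite (dom A)" shows "A \<preceq>\<^sub>p A"
  unfolding postproc_def
  by (rule exI[of _ "\<lambda>x y. if x = y then 1 else 0"])
    (use assms in \<open>auto simp: if_distrib if_distribR cong: if_cong\<close>)

lemma postproc_trans:
  assumes "A \<preceq>\<^sub>p B" and "B \<preceq>\<^sub>p C"
  shows "A \<preceq>\<^sub>p C"
proof -
  obtain m where m: "\<forall>x\<in>dom A. \<forall>y\<in>dom B. 0 \<le> m x y" "\<forall>y\<in>dom B. (\<Sum>x\<in>dom A. m x y) = 1"
    "\<forall>x\<in>dom A. eff A x = (\<Sum>y\<in>dom B. m x y *\<^sub>R eff B y)"
    using assms(1) unfolding postproc_def by blast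
  obtain n where n: "\<forall>y\<in>dom B. \<forall>z\<in>dom C. 0 \<le> n y z" "\<forall>z\<in>dom C. (\<Sum>y\<in>dom B. n y z) = 1"
    "\<forall>y\<in>dom B. eff B y = (\<Sum>z\<in>dom C. n y z *\<^sub>R eff C z)"
    using assms(2) unfolding postproc_def by blast
  \<comment> \<open>Composition of post-processings is the product of their stochastic
    matrices.\<close>
  define k where "k x z = (\<Sum>y\<in>dom B. m x y * n y z)" for x z
  have "(\<Sum>x\<in>dom A. k x z) = 1" if "z \<in> dom C" for z
  proof -
    have "(\<Sum>x\<in>dom A. k x z) = (\<Sum>y\<in>dom B. \<Sum>x\<in>dom A. m x y * n y z)"
      unfolding k_def by (rule sum.swap)
    also have "\<dots> = (\<Sum>y\<in>dom B. n y z)"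
      using m(2) by (simp flip: sum_distrib_right)
    finally show ?thesis using n(2) that by simp
  qed
  moreover have "eff A x = (\<Sum>z\<in>dom C. k x z *\<^sub>R eff C z)" if "x \<in> dom A" for x
  proof -
    have "eff A x = (\<Sum>y\<in>dom B. \<Sum>z\<in>dom C. (m x y * n y z) *\<^sub>R eff C z)"
      using m(3) n(3) that by (simp add: scaleR_right.sum)
    also have "\<dots> = (\<Sum>z\<in>dom C. \<Sum>y\<in>dom B. (m x y * n y z) *\<^sub>R eff C z)"
      by (rule sum.swap)
    finally show ?thesis by (simp add: k_def scaleR_left.sum)
  qed
  moreover have "0 \<le> k x z" if "x \<in> dom A" "z \<in> dom C" for x z
    using m(1) n(1) that unfolding k_def by (intro sum_nonneg mult_nonneg_nonneg) blast+
  ultimately show ?thesis unfolding postproc_def by blast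
qed

text \<open>Outcome \<open>x\<close> is absorbed into \<open>y\<close>, whose new effect (1 + c) A_y
  is A_x + A_y. The original is recovered by random splitting; \<open>c = 0\<close> covers a zero
  effect at \<open>x\<close>.\<close>

lemma merge_collinear:
  assumes A: "measurement A" and x: "x \<in> dom A" and y: "y \<in> dom A" and xy: "x \<noteq> y"
    and c: "0 \<le> c" and eq: "eff A x = c *\<^sub>R eff A y"
  obtains B where "measurement B" "card (dom B) < card (dom A)" "A \<preceq>\<^sub>p B" "B \<preceq>\<^sub>p A"
proof -
  define D where "D = dom A - {x}"
  define B where "B = (A |` D)(y \<mapsto> (1 + c) *\<^sub>R eff A y)"
  have fin: "finite (dom A)" using A by (simp add: measurement_def)
  have D: "dom A = insert x D" "x \<notin> D" "finite D" "y \<in> D"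
    using x y xy fin by (auto simp: D_def)
  have dom: "dom B = D" using D by (auto simp: B_def D_def)
  have eff: "eff B z = (if z = y then (1 + c) *\<^sub>R eff A y else eff A z)" if "z \<in> D" for z
    using that by (auto simp: B_def eff_def)
  have c1: "1 + c \<noteq> 0" "c / (1 + c) + 1 / (1 + c) = 1"
    using c by (auto simp flip: add_divide_distrib)
  have merged: "(\<Sum>w\<in>D. f w *\<^sub>R eff B w) = (f y * (1 + c)) *\<^sub>R eff A y + (\<Sum>w\<in>D - {y}. f w *\<^sub>R eff A w)"
    for f :: "int \<Rightarrow> real"
    using D by (simp add: sum.remove[of D y] eff)
  show ?thesis
  proof
    have "psd (eff B z)" if "z \<in> D" for z
      using A that D c by (auto simp: eff measurement_def intro!: psd_scaleR)
    moreover have "(\<Sum>z\<in>D. eff B z) = mat 1"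
    proof -
      have "(\<Sum>z\<in>dom A. eff A z) = (\<Sum>z\<in>D. eff B z)"
        using merged[of "\<lambda>_. 1"] D sum.remove[of D y "eff A"] by (simp add: eq scaleR_left_distrib)
      then show ?thesis using A by (simp add: measurement_def)
    qed
    ultimately show "measurement B" using D by (simp add: measurement_def dom)
    show "card (dom B) < card (dom A)" using D by (simp add: dom)
    \<comment> \<open>The splitting kernel: the merged outcome \<open>y\<close> is sent to
      \<open>x\<close> with probability \<open>c / (1 + c)\<close> and otherwise stays.\<close>
    define m :: "int \<Rightarrow> int \<Rightarrow> real" where
      "m z w = (if w = y then if z = y then 1 / (1 + c) else if z = x then c / (1 + c) else 0
                else if z = w then 1 else 0)" for z w
    show "A \<preceq>\<^sub>p B"
      unfolding postproc_def dom
    proof (intro exI[of _ m] conjI ballI)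
      fix w assume w: "w \<in> D"
      show "(\<Sum>z\<in>dom A. m z w) = 1"
      proof (cases "w = y")
        case True
        have "(\<Sum>z\<in>D. m z y) = (\<Sum>z\<in>D. if z = y then 1 / (1 + c) else 0)"
          using D by (intro sum.cong) (auto simp: m_def)
        then show ?thesis using D c1 xy True by (simp add: m_def)
      next
        case False
        have "(\<Sum>z\<in>D. m z w) = (\<Sum>z\<in>D. if z = w then 1 else 0)"
          using D False by (intro sum.cong) (auto simp: m_def)
        then show ?thesis using D w False by (auto simp: m_def)
      qed
    next
      fix z assume z: "z \<in> dom A"
      have "(\<Sum>w\<in>D - {y}. m z w *\<^sub>R eff A w) = (\<Sum>w\<in>D - {y}. if z = w then eff A w else 0)"
        by (intro sum.cong) (auto simp: m_def)
      also have "\<dots> = (if z \<in> D - {y} then eff A z else 0)"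
        using D by simp
      finally show "eff A z = (\<Sum>w\<in>D. m z w *\<^sub>R eff B w)"
        using D z c1 xy eq unfolding merged by (auto simp: m_def)
    qed (use c in \<open>auto simp: m_def\<close>)
    \<comment> \<open>The deterministic merging kernel, sending \<open>x\<close> to \<open>y\<close>
      and fixing every other outcome.\<close>
    define n :: "int \<Rightarrow> int \<Rightarrow> real" where
      "n z w = (if z = (if w = x then y else w) then 1 else 0)" for z w
    show "B \<preceq>\<^sub>p A"
      unfolding postproc_def dom
    proof (intro exI[of _ n] conjI ballI)
      fix w assume w: "w \<in> dom A"
      show "(\<Sum>z\<in>D. n z w) = 1" using w D by (auto simp: n_def)
    next
      fix z assume z: "z \<in> D"
      have "(\<Sum>w\<in>D. n z w *\<^sub>R eff A w) = (\<Sum>w\<in>D. if z = w then eff A w else 0)"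
        using D by (intro sum.cong) (auto simp: n_def)
      then show "eff B z = (\<Sum>w\<in>dom A. n z w *\<^sub>R eff A w)"
        using D z by (auto simp: eff n_def eq scaleR_left_distrib)
    qed (auto simp: n_def)
  qed
qed

text \<open>Collinear pairs are merged as long as there are any; each merging lowers the number of
  outcomes, so the process stops.\<close>

lemma simple_representative_exists:
  "measurement A \<Longrightarrow> \<exists>B. measurement B \<and> simple B \<and> A \<preceq>\<^sub>p B \<and> B \<preceq>\<^sub>p A"
proof (induction "card (dom A)" arbitrary: A rule: less_induct)
  case less
  show ?case
  proof (cases "simple A")
    case True
    then show ?thesis using less.prems postproc_refl by (auto simp: measurement_def)
  next
    case False
    then obtain x y c where "x \<in> dom A" "y \<in> dom A" "x \<noteq> y" "0 \<le> c" "eff A x = c *\<^sub>R eff A y"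
      by (auto simp: simple_def)
    then obtain B where B: "measurement B" "card (dom B) < card (dom A)" "A \<preceq>\<^sub>p B" "B \<preceq>\<^sub>p A"
      using merge_collinear[OF less.prems] by metis
    then show ?thesis using less.hyps[OF B(2,1)] postproc_trans by blast
  qed
qed

lemma simple_rep:
  assumes "measurement A"
  shows "measurement (simple_rep A)" "A \<preceq>\<^sub>p simple_rep A" "simple_rep A \<preceq>\<^sub>p A"
  using someI_ex[OF simple_representative_exists[OF assms]] by (auto simp: simple_rep_def)

section \<open>A joint measurement indexed by tuples\<close>

text \<open>The marginal of a product distribution: the indicator of \<open>f i = x\<close> is
  absorbed into the factor at \<open>i\<close>, the sum over tuples factorizes, and all other
  factors sum to 1.\<close>

lemma marginal_prod:
  fixes p :: "'i \<Rightarrow> 'x \<Rightarrow> 'a::comm_semiring_1"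
  assumes I: "finite I" "i \<in> I" and S: "\<And>k. k \<in> I \<Longrightarrow> finite (S k)"
    and p: "\<And>k. k \<in> I \<Longrightarrow> (\<Sum>x\<in>S k. p k x) = 1" and x: "x \<in> S i"
  shows "(\<Sum>f\<in>Pi\<^sub>E I S. if f i = x then \<Prod>k\<in>I. p k (f k) else 0) = p i x"
proof -
  define q where "q k z = (if k = i \<and> z \<noteq> x then 0 else p k z)" for k z
  have "(\<Sum>f\<in>Pi\<^sub>E I S. if f i = x then \<Prod>k\<in>I. p k (f k) else 0) = (\<Sum>f\<in>Pi\<^sub>E I S. \<Prod>k\<in>I. q k (f k))"
  proof (rule sum.cong)
    fix f
    have "(\<Prod>k\<in>I. q k (f k)) = 0" if "f i \<noteq> x"
      using that I by (intro prod_zero) (auto simp: q_def)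
    then show "(if f i = x then \<Prod>k\<in>I. p k (f k) else 0) = (\<Prod>k\<in>I. q k (f k))"
      by (auto simp: q_def intro: prod.cong)
  qed simp
  also have "\<dots> = (\<Prod>k\<in>I. \<Sum>z\<in>S k. q k z)"
    using I S by (simp add: prod_sum_PiE)
  also have "\<dots> = (\<Prod>k\<in>I. if k = i then p i x else 1)"
  proof (rule prod.cong)
    fix k assume k: "k \<in> I"
    have "(\<Sum>z\<in>S i. q i z) = (\<Sum>z\<in>S i. if z = x then p i z else 0)"
      by (intro sum.cong) (auto simp: q_def)
    then show "(\<Sum>z\<in>S k. q k z) = (if k = i then p i x else 1)"
      using S[OF I(2)] x p[OF k] by (auto simp: q_def)
  qed simp
  finally show ?thesis using I by simp
qed

text \<open>Independent post-processings of a common refinement \<open>C\<close> can be carried out jointly, which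
  yields a joint measurement indexed by tuples of outcomes.\<close>

lemma joint_povm:
  assumes C: "measurement C" and I: "finite I"
    and B: "\<And>i. i \<in> I \<Longrightarrow> finite (dom (B i))" "\<And>i. i \<in> I \<Longrightarrow> B i \<preceq>\<^sub>p C"
  obtains D where "povm (Pi\<^sub>E I (\<lambda>i. dom (B i))) D"
    "\<And>i x. i \<in> I \<Longrightarrow> x \<in> dom (B i) \<Longrightarrow>
      eff (B i) x = (\<Sum>f\<in>Pi\<^sub>E I (\<lambda>i. dom (B i)). if f i = x then D f else 0)"
proof -
  have "\<forall>i\<in>I. \<exists>\<mu> :: int \<Rightarrow> int \<Rightarrow> real.
        (\<forall>x\<in>dom (B i). \<forall>y\<in>dom C. 0 \<le> \<mu> x y) \<and>
        (\<forall>y\<in>dom C. (\<Sum>x\<in>dom (B i). \<mu> x y) = 1) \<and>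
        (\<forall>x\<in>dom (B i). eff (B i) x = (\<Sum>y\<in>dom C. \<mu> x y *\<^sub>R eff C y))"
    using B(2) unfolding postproc_def by blast
  from bchoice[OF this] obtain m :: "_ \<Rightarrow> int \<Rightarrow> int \<Rightarrow> real" where m: "\<forall>i\<in>I.
        (\<forall>x\<in>dom (B i). \<forall>y\<in>dom C. 0 \<le> m i x y) \<and>
        (\<forall>y\<in>dom C. (\<Sum>x\<in>dom (B i). m i x y) = 1) \<and>
        (\<forall>x\<in>dom (B i). eff (B i) x = (\<Sum>y\<in>dom C. m i x y *\<^sub>R eff C y))" ..
  have m0: "0 \<le> m i x y" if "i \<in> I" "x \<in> dom (B i)" "y \<in> dom C" for i x y
    using bspec[OF m that(1)] that by blast
  have m1: "(\<Sum>x\<in>dom (B i). m i x y) = 1" if "i \<in> I" "y \<in> dom C" for i y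
    using bspec[OF m that(1)] that by blast
  have mB: "eff (B i) x = (\<Sum>y\<in>dom C. m i x y *\<^sub>R eff C y)" if "i \<in> I" "x \<in> dom (B i)" for i x
    using bspec[OF m that(1)] that by blast
  let ?J = "Pi\<^sub>E I (\<lambda>i. dom (B i))"
  \<comment> \<open>Given the outcome \<open>y\<close> of \<open>C\<close>, the components of the
    tuple are drawn independently with the kernels \<open>m i\<close>.\<close>
  define D where "D f = (\<Sum>y\<in>dom C. (\<Prod>i\<in>I. m i (f i) y) *\<^sub>R eff C y)" for f
  have finJ: "finite ?J" using I B(1) by (intro finite_PiE) auto
  show ?thesis
  proof
    have "psd (D f)" if "f \<in> ?J" for f
      using that C unfolding D_def
      by (intro psd_sum psd_scaleR prod_nonneg ballI m0) (auto simp: measurement_def PiE_def Pi_def)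
    moreover have "sum D ?J = mat 1"
    proof -
      have "sum D ?J = (\<Sum>y\<in>dom C. \<Sum>f\<in>?J. (\<Prod>i\<in>I. m i (f i) y) *\<^sub>R eff C y)"
        unfolding D_def by (rule sum.swap)
      also have "\<dots> = (\<Sum>y\<in>dom C. (\<Prod>i\<in>I. \<Sum>x\<in>dom (B i). m i x y) *\<^sub>R eff C y)"
        using I B(1) by (subst prod_sum_PiE) (simp_all add: scaleR_left.sum)
      also have "\<dots> = (\<Sum>y\<in>dom C. eff C y)" by (simp add: m1)
      finally show ?thesis using C by (simp add: measurement_def)
    qed
    ultimately show "povm ?J D" using finJ by (simp add: povm_def)
    fix i x assume i: "i \<in> I" and x: "x \<in> dom (B i)"
    have "(\<Sum>f\<in>?J. if f i = x then D f else 0)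
        = (\<Sum>f\<in>?J. \<Sum>y\<in>dom C. (if f i = x then \<Prod>i\<in>I. m i (f i) y else 0) *\<^sub>R eff C y)"
      by (intro sum.cong) (auto simp: D_def)
    also have "\<dots> = (\<Sum>y\<in>dom C. \<Sum>f\<in>?J. (if f i = x then \<Prod>i\<in>I. m i (f i) y else 0) *\<^sub>R eff C y)"
      by (rule sum.swap)
    also have "\<dots> = (\<Sum>y\<in>dom C. m i x y *\<^sub>R eff C y)"
    proof (rule sum.cong)
      fix y assume y: "y \<in> dom C"
      have "(\<Sum>f\<in>?J. if f i = x then \<Prod>i\<in>I. m i (f i) y else 0) = m i x y"
        by (rule marginal_prod[OF I i, where p = "\<lambda>i x. m i x y" and S = "\<lambda>i. dom (B i)"])
          (fact B(1) | fact m1[OF _ y] | fact x)+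
      then show "(\<Sum>f\<in>?J. (if f i = x then \<Prod>i\<in>I. m i (f i) y else 0) *\<^sub>R eff C y)
          = m i x y *\<^sub>R eff C y"
        by (simp only: scaleR_left.sum[symmetric])
    qed simp
    finally show "eff (B i) x = (\<Sum>f\<in>?J. if f i = x then D f else 0)"
      using mB[OF i x] by simp
  qed
qed

section \<open>The height bound for compatible families\<close>

text \<open>Each \<open>A i\<close> is a post-processing of its simple representative, a marginal of
  the joint \<open>D\<close>, so the Fisher matrix of \<open>D\<close> is admissible in the
  definition of \<open>height\<close>. Using the representatives makes the number of tuples the
  product of the \<open>num_outcomes\<close>.\<close>

lemma compatible_height_le:
  fixes A :: "'i \<Rightarrow> 'd::finite effects"
  assumes I: "finite I" "I \<noteq> {}" and A: "\<And>i. i \<in> I \<Longrightarrow> measurement (A i)"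
    and comp: "compatible (A ` I)" and \<rho>: "faithful_state \<rho>"
  shows "height I (\<lambda>i. fisher \<rho> (A i)) \<le> real (min CARD('d) (\<Prod>i\<in>I. num_outcomes (A i)))"
proof -
  obtain C where C: "measurement C" "\<And>i. i \<in> I \<Longrightarrow> A i \<preceq>\<^sub>p C"
    using comp by (auto simp: compatible_def)
  define B where "B i = simple_rep (A i)" for i
  have B: "finite (dom (B i))" "A i \<preceq>\<^sub>p B i" "B i \<preceq>\<^sub>p C" if "i \<in> I" for i
    using simple_rep[OF A[OF that]] C(2)[OF that] postproc_trans
    by (auto simp: B_def measurement_def)
  let ?J = "Pi\<^sub>E I (\<lambda>i. dom (B i))"
  obtain D where D: "povm ?J D" and marg: "\<And>i x. i \<in> I \<Longrightarrow> x \<in> dom (B i) \<Longrightarrow>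
      eff (B i) x = (\<Sum>f\<in>?J. if f i = x then D f else 0)"
    by (rule joint_povm[OF C(1) I(1), of B]) (blast intro: B(1,3))+
  have "psd (fisher_sum \<rho> ?J D - fisher \<rho> (A i))" if i: "i \<in> I" for i
  proof -
    obtain m where m: "\<forall>x\<in>dom (A i). \<forall>y\<in>dom (B i). 0 \<le> m x y"
      "\<forall>y\<in>dom (B i). (\<Sum>x\<in>dom (A i). m x y) = 1"
      "\<forall>x\<in>dom (A i). eff (A i) x = (\<Sum>y\<in>dom (B i). m x y *\<^sub>R eff (B i) y)"
      using B(2)[OF i] unfolding postproc_def by blast
    have f: "f i \<in> dom (B i)" if "f \<in> ?J" for f using that i by (rule PiE_mem)
    \<comment> \<open>Marginalizing to component \<open>i\<close> and then applying \<open>m\<close>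
      is one post-processing of \<open>D\<close>, with kernel \<open>m x (f i)\<close>.\<close>
    have "eff (A i) x = (\<Sum>f\<in>?J. m x (f i) *\<^sub>R D f)" if "x \<in> dom (A i)" for x
    proof -
      have "eff (A i) x = (\<Sum>y\<in>dom (B i). \<Sum>f\<in>?J. if f i = y then m x y *\<^sub>R D f else 0)"
        using m(3) that by (simp add: marg[OF i] scaleR_right.sum if_distrib cong: if_cong)
      also have "\<dots> = (\<Sum>f\<in>?J. \<Sum>y\<in>dom (B i). if f i = y then m x y *\<^sub>R D f else 0)"
        by (rule sum.swap)
      also have "\<dots> = (\<Sum>f\<in>?J. m x (f i) *\<^sub>R D f)"
        using B(1)[OF i] f by (intro sum.cong) auto
      finally show ?thesis .
    qed
    then have "psd (fisher_sum \<rho> ?J D - fisher_sum \<rho> (dom (A i)) (eff (A i)))"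
      using D m(1,2) f by (intro fisher_sum_mono[where m = "\<lambda>x f. m x (f i)"] \<rho>) (auto simp: povm_def)
    then show ?thesis
      using A[OF i] by (simp add: fisher_eq_fisher_sum measurement_def)
  qed
  then have "height I (\<lambda>i. fisher \<rho> (A i)) \<le> Re (trace (fisher_sum \<rho> ?J D))"
    using I(2) by (auto intro: height_le selfadjoint_fisher_sum)
  also have "\<dots> \<le> real (min CARD('d) (card ?J))"
    by (rule Re_trace_fisher_povm_le[OF \<rho> D])
  also have "card ?J = (\<Prod>i\<in>I. num_outcomes (A i))"
    using I(1) by (simp add: card_PiE num_outcomes_def B_def)
  finally show ?thesis .
qed

theorem theorem5p14:
  fixes A :: "nat \<Rightarrow> 'd::finite effects" and g :: nat
  assumes "g \<ge> 1"
    and "\<And>i. i \<in> {1..g} \<Longrightarrow> measurement (A i)"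
    and "\<exists>\<rho>. faithful_state \<rho> \<and>
           height {1..g} (\<lambda>i. fisher \<rho> (A i)) >
             real (min CARD('d) (\<Prod>i = 1..g. num_outcomes (A i)))"
  shows "incompatible (A ` {1..g})"
proof -
  obtain \<rho> where \<rho>: "faithful_state \<rho>" and
    gt: "height {1..g} (\<lambda>i. fisher \<rho> (A i)) > real (min CARD('d) (\<Prod>i = 1..g. num_outcomes (A i)))"
    using assms(3) by blast
  \<comment> \<open>A nonempty family makes the infimum in \<open>height\<close> bounded
    below.\<close>
  have "{1..g} \<noteq> {}" using assms(1) by simp
  then have "height {1..g} (\<lambda>i. fisher \<rho> (A i)) \<le> real (min CARD('d) (\<Prod>i = 1..g. num_outcomes (A i)))"
    if "compatible (A ` {1..g})"
    using compatible_height_le[OF _ _ assms(2) that \<rho>] by blast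
  then show ?thesis using gt unfolding incompatible_def by linarith
qed

end
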